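(* Let $A,B,X\in\mathcal{M}_n$ be such that the block matrix $\begin{bmatrix} A & X^*\\ X & B\end{bmatrix}\in\mathcal{M}_{2n}$ is positive semidefinite, and let $X=U|X|$ be a polar decomposition of $X$ with $U\in\mathcal{M}_n$ unitary. Then for every $0\le t\le 1$, $$|X|\le \left(A\sharp_t U^*BU\right)\sharp\left(A\sharp_{1-t}U^*BU\right)$$ and $$|X^*|\le \left(UAU^*\sharp_t B\right)\sharp\left(UAU^*\sharp_{1-t}B\right).$$ In particular, $|X|\le A\sharp U^*BU$ and $|X^*|\le UAU^*\sharp B$.
   Context: $\mathcal{M}_n$ is the algebra of $n\times n$ complex matrices. $A\ge O$ means $A$ is positive semidefinite, $A>O$ means positive definite, and $A\le B$ means $B-A\ge O$ (Loewner order). $|X|=(X^*X)^{1/2}$. For $A,B>O$ and $0\le t\le 1$, the weighted geometric mean is $A\sharp_t B=A^{1/2}(A^{-1/2}BA^{-1/2})^tA^{1/2}$, and $A\sharp B=A\sharp_{1/2}B$. For positive semidefinite $A,B$, $A\sharp_t B$ is understood as $\lim_{\varepsilon\to0^+}(A+\varepsilon I)\sharp_t(B+\varepsilon I)$. Polar decomposition $X=U|X|$ is taken with $U$ unitary. *)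

theory Defs
  imports "HOL-Analysis.Analysis"
begin

type_synonym 'n cmat = "complex ^ 'n ^ 'n"

definition mat_adjoint :: "'n::finite cmat \<Rightarrow> 'n cmat"  ("(_\<^sup>\<dagger>)" [1000] 999) where
  "A\<^sup>\<dagger> = (\<chi> i j. cnj (A $ j $ i))"

definition hermitian :: "'n::finite cmat \<Rightarrow> bool" where
  "hermitian A \<longleftrightarrow> A\<^sup>\<dagger> = A"

definition unitary :: "'n::finite cmat \<Rightarrow> bool" where
  "unitary U \<longleftrightarrow> U\<^sup>\<dagger> ** U = mat 1 \<and> U ** U\<^sup>\<dagger> = mat 1"

definition quad_form :: "'n::finite cmat \<Rightarrow> complex ^ 'n \<Rightarrow> complex" where
  "quad_form A x = (\<Sum>i\<in>UNIV. cnj (x $ i) * (A *v x) $ i)"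

text \<open>For Hermitian \<open>A\<close> the quadratic form is real, so taking \<open>Re\<close> loses nothing.\<close>

definition pos_semidef :: "'n::finite cmat \<Rightarrow> bool" where
  "pos_semidef A \<longleftrightarrow> hermitian A \<and> (\<forall>x. 0 \<le> Re (quad_form A x))"

definition pos_def :: "'n::finite cmat \<Rightarrow> bool" where
  "pos_def A \<longleftrightarrow> hermitian A \<and> (\<forall>x. x \<noteq> 0 \<longrightarrow> 0 < Re (quad_form A x))"

definition loewner_le :: "'n::finite cmat \<Rightarrow> 'n cmat \<Rightarrow> bool"  (infix "\<preceq>" 50) where
  "A \<preceq> B \<longleftrightarrow> pos_semidef (B - A)"

definition diag_mat :: "('n::finite \<Rightarrow> real) \<Rightarrow> 'n cmat" where
  "diag_mat d = (\<chi> i j. if i = j then complex_of_real (d i) else 0)"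

text \<open>
  Functional calculus for Hermitian matrices through a unitary diagonalisation. The result does
  not depend on the diagonalisation chosen; for non-Hermitian \<open>A\<close> it is unspecified.
\<close>

definition mat_fun :: "(real \<Rightarrow> real) \<Rightarrow> 'n::finite cmat \<Rightarrow> 'n cmat" where
  "mat_fun f A = (THE B. \<exists>U d. unitary U \<and> A = U ** diag_mat d ** U\<^sup>\<dagger> \<and>
                                B = U ** diag_mat (\<lambda>i. f (d i)) ** U\<^sup>\<dagger>)"

text \<open>
  Used below for positive definite \<open>A\<close> and any real exponent, and for positive semidefinite \<open>A\<close>
  with exponent \<open>1/2\<close> (where \<open>0 powr (1/2) = 0\<close> gives the usual square root).
\<close>

definition mat_powr :: "'n::finite cmat \<Rightarrow> real \<Rightarrow> 'n cmat" where
  "mat_powr A t = mat_fun (\<lambda>x. x powr t) A"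

definition mat_abs :: "'n::finite cmat \<Rightarrow> 'n cmat" where
  "mat_abs X = mat_powr (X\<^sup>\<dagger> ** X) (1/2)"

definition geo_mean_pd :: "real \<Rightarrow> 'n::finite cmat \<Rightarrow> 'n cmat \<Rightarrow> 'n cmat" where
  "geo_mean_pd t A B =
     mat_powr A (1/2) ** mat_powr (mat_powr A (-1/2) ** B ** mat_powr A (-1/2)) t ** mat_powr A (1/2)"

definition geo_mean :: "'n::finite cmat \<Rightarrow> real \<Rightarrow> 'n cmat \<Rightarrow> 'n cmat"
    ("(_ \<sharp>\<^bsub>_\<^esub> _)" [71, 0, 71] 70) where
  "A \<sharp>\<^bsub>t\<^esub> B =
     (if pos_def A \<and> pos_def B then geo_mean_pd t A B
      else Lim (at_right 0) (\<lambda>\<epsilon>. geo_mean_pd t (A + \<epsilon> *\<^sub>R mat 1) (B + \<epsilon> *\<^sub>R mat 1)))"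

abbreviation geo_mean_half :: "'n::finite cmat \<Rightarrow> 'n cmat \<Rightarrow> 'n cmat"
    ("(_ \<sharp> _)" [71, 71] 70) where
  "A \<sharp> B \<equiv> A \<sharp>\<^bsub>1/2\<^esub> B"

definition block_mat :: "'n::finite cmat \<Rightarrow> 'n cmat \<Rightarrow> 'n cmat \<Rightarrow> 'n cmat \<Rightarrow> ('n + 'n) cmat" where
  "block_mat P Q R S = (\<chi> i j. case (i, j) of
       (Inl k, Inl l) \<Rightarrow> P $ k $ l
     | (Inl k, Inr l) \<Rightarrow> Q $ k $ l
     | (Inr k, Inl l) \<Rightarrow> R $ k $ l
     | (Inr k, Inr l) \<Rightarrow> S $ k $ l)"

end

theory Submission
  imports Defs
begin

text \<open>
  The main tool is an extremal property: if the block matrix with diagonal blocks \<open>P\<close>, \<open>Q\<close> and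
  Hermitian off-diagonal blocks \<open>G\<close> is positive semidefinite, then \<open>G \<preceq> P \<sharp> Q\<close>. A congruence by
  the unitary factor of \<open>X\<close> turns the hypothesis into such a block matrix with off-diagonal
  block \<open>|X|\<close> (or \<open>|X\<^sup>*|\<close>), which gives \<open>|X| \<preceq> A \<sharp> C\<close> for \<open>C = U\<^sup>\<dagger> B U\<close>. Diagonalising \<open>A\<close> and
  \<open>C\<close> simultaneously by a congruence shows that \<open>A \<sharp> C\<close> is in turn admissible as the off-diagonal
  block for \<open>A \<sharp>\<^bsub>t\<^esub> C\<close> and \<open>A \<sharp>\<^bsub>1 - t\<^esub> C\<close>. In the semidefinite case the defining limit exists
  because the means are monotone, so that they decrease with \<open>\<epsilon>\<close>.
\<close>

section \<open>Matrix algebra\<close>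

text \<open>The complex inner product, conjugate-linear in its first argument; its real part is the
  library's real inner product. Orthonormality of the columns of a unitary matrix needs the complex
  one, while quadratic forms and the Loewner order need only the real one.\<close>

definition cip :: "complex ^ 'n::finite \<Rightarrow> complex ^ 'n \<Rightarrow> complex" where
  "cip x y = (\<Sum>i\<in>UNIV. cnj (x $ i) * y $ i)"

lemma Re_cip: "Re (cip x y) = x \<bullet> y"
  by (simp add: cip_def inner_vec_def inner_complex_def)

lemma cip_commute: "cip y x = cnj (cip x y)"
  by (simp add: cip_def mult.commute)

lemma cip_add_right: "cip x (y + z) = cip x y + cip x z"
  by (simp add: cip_def algebra_simps sum.distrib)

lemma cip_scaleR_right: "cip x (r *\<^sub>R y) = of_real r * cip x y"
  by (simp add: cip_def scaleR_sum_right flip: scaleR_conv_of_real)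

lemma cip_scaleR_left: "cip (r *\<^sub>R x) y = of_real r * cip x y"
  by (metis cip_commute cip_scaleR_right complex_cnj_complex_of_real complex_cnj_mult)

lemma cip_self: "cip x x = of_real (x \<bullet> x)"
  by (rule complex_eqI) (simp_all add: Re_cip, simp add: cip_def)

lemma cip_adjoint: "cip x (A *v y) = cip (A\<^sup>\<dagger> *v x) y"
proof -
  have "cip x (A *v y) = (\<Sum>i\<in>UNIV. \<Sum>j\<in>UNIV. cnj (x $ i) * (A $ i $ j * y $ j))"
    by (simp add: cip_def matrix_vector_mult_def sum_distrib_left)
  also have "\<dots> = (\<Sum>j\<in>UNIV. \<Sum>i\<in>UNIV. cnj (x $ i) * (A $ i $ j * y $ j))"
    by (rule sum.swap)
  also have "\<dots> = cip (A\<^sup>\<dagger> *v x) y"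
    by (simp add: cip_def matrix_vector_mult_def mat_adjoint_def sum_distrib_left sum_distrib_right mult_ac)
  finally show ?thesis .
qed

lemma inner_adjoint: "x \<bullet> (A *v y) = (A\<^sup>\<dagger> *v x) \<bullet> y"
  by (metis Re_cip cip_adjoint)

lemma Re_quad_form: "Re (quad_form A x) = x \<bullet> (A *v x)"
  by (simp add: quad_form_def flip: cip_def Re_cip)

lemma adjoint_adjoint [simp]: "(A\<^sup>\<dagger>)\<^sup>\<dagger> = A"
  by (simp add: mat_adjoint_def vec_eq_iff)

lemma adjoint_mult: "(A ** B)\<^sup>\<dagger> = B\<^sup>\<dagger> ** A\<^sup>\<dagger>"
  by (simp add: mat_adjoint_def matrix_matrix_mult_def vec_eq_iff mult.commute)

lemma adjoint_mat_1 [simp]: "(mat 1)\<^sup>\<dagger> = mat 1"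
  by (auto simp: mat_adjoint_def mat_def vec_eq_iff)

lemma adjoint_diag_mat [simp]: "(diag_mat d)\<^sup>\<dagger> = diag_mat d"
  by (auto simp: mat_adjoint_def diag_mat_def vec_eq_iff)

lemma adjoint_add: "(A + B)\<^sup>\<dagger> = A\<^sup>\<dagger> + B\<^sup>\<dagger>"
  by (simp add: mat_adjoint_def vec_eq_iff)

lemma adjoint_diff: "(A - B)\<^sup>\<dagger> = A\<^sup>\<dagger> - B\<^sup>\<dagger>"
  by (simp add: mat_adjoint_def vec_eq_iff)

lemma adjoint_scaleR: "(r *\<^sub>R A)\<^sup>\<dagger> = r *\<^sub>R A\<^sup>\<dagger>"
  by (simp add: mat_adjoint_def vec_eq_iff)

lemma mult_diag_mat_entry:
  "(A ** diag_mat d) $ i $ j = A $ i $ j * d j" "(diag_mat d ** A) $ i $ j = d i * A $ i $ j"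
  by (simp_all add: matrix_matrix_mult_def diag_mat_def if_distrib if_distribR cong: if_cong)

lemma diag_mat_mult: "diag_mat d ** diag_mat e = diag_mat (\<lambda>i. d i * e i)"
  by (simp add: vec_eq_iff mult_diag_mat_entry) (simp add: diag_mat_def)

lemma diag_mat_1 [simp]: "diag_mat (\<lambda>i. 1) = mat 1"
  by (simp add: diag_mat_def mat_def vec_eq_iff)

lemma diag_mat_mult_vec: "(diag_mat d *v x) $ i = d i *\<^sub>R x $ i"
  by (simp add: diag_mat_def matrix_vector_mult_def if_distrib if_distribR scaleR_conv_of_real cong: if_cong)

lemma inner_diag_mat: "x \<bullet> (diag_mat d *v x) = (\<Sum>i\<in>UNIV. d i * (x $ i \<bullet> x $ i))"
  by (simp add: inner_vec_def diag_mat_mult_vec)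

lemma matrix_mult_diff_left: "A ** (B - C) = A ** B - A ** (C :: 'n::finite cmat)"
  by (simp add: matrix_matrix_mult_def vec_eq_iff algebra_simps sum_subtractf)

lemma matrix_mult_diff_right: "(B - C) ** A = B ** A - C ** (A :: 'n::finite cmat)"
  by (simp add: matrix_matrix_mult_def vec_eq_iff algebra_simps sum_subtractf)

lemma scaleR_matrix_vector: "(r *\<^sub>R A) *v x = r *\<^sub>R (A *v (x :: complex ^ 'n::finite))"
  by (simp add: matrix_vector_mult_def vec_eq_iff scaleR_sum_right)

lemma matrix_vector_scaleR: "A *v (r *\<^sub>R x) = r *\<^sub>R (A *v (x :: complex ^ 'n::finite))"
  by (simp add: matrix_vector_mult_def vec_eq_iff scaleR_sum_right)

lemma hermitian_mult_adjoint: "hermitian D \<Longrightarrow> hermitian (S ** D ** S\<^sup>\<dagger>)"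
  by (simp add: hermitian_def adjoint_mult matrix_mul_assoc)

lemma hermitian_diag_mat [simp]: "hermitian (diag_mat d)"
  by (simp add: hermitian_def)

section \<open>Positivity and the Loewner order through the real inner product\<close>

lemma pos_semidef_iff: "pos_semidef A \<longleftrightarrow> hermitian A \<and> (\<forall>x. 0 \<le> x \<bullet> (A *v x))"
  by (simp add: pos_semidef_def Re_quad_form)

lemma pos_def_iff: "pos_def A \<longleftrightarrow> hermitian A \<and> (\<forall>x. x \<noteq> 0 \<longrightarrow> 0 < x \<bullet> (A *v x))"
  by (simp add: pos_def_def Re_quad_form)

text \<open>Two different outer factors are allowed so that off-diagonal blocks are covered as well
  as quadratic forms.\<close>

lemma inner_congruence: "x \<bullet> ((R ** M ** S\<^sup>\<dagger>) *v y) = (R\<^sup>\<dagger> *v x) \<bullet> (M *v (S\<^sup>\<dagger> *v y))"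
  by (simp add: inner_adjoint[of _ R] flip: matrix_vector_mul_assoc)

lemma loewner_leD: "A \<preceq> B \<Longrightarrow> x \<bullet> (A *v x) \<le> x \<bullet> (B *v x)"
  by (simp add: loewner_le_def pos_semidef_iff matrix_vector_mult_diff_rdistrib inner_diff_right)

lemma loewner_leI:
  assumes "hermitian A" "hermitian B" "\<And>x. x \<bullet> (A *v x) \<le> x \<bullet> (B *v x)"
  shows "A \<preceq> B"
  using assms by (simp add: loewner_le_def pos_semidef_iff matrix_vector_mult_diff_rdistrib
      inner_diff_right hermitian_def adjoint_diff)

lemma loewner_le_trans:
  assumes "A \<preceq> B" "B \<preceq> C"
  shows "A \<preceq> C"
proof -
  have "C - A = (C - B) + (B - A)"
    by simp
  then show ?thesis
    using assms unfolding loewner_le_def pos_semidef_iff hermitian_def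
    by (metis (no_types, lifting) add_nonneg_nonneg adjoint_add inner_add_right matrix_vector_mult_add_rdistrib)
qed

section \<open>The spectral theorem and functional calculus\<close>

text \<open>Too few linear conditions leave a nonzero solution: written as rows of a square matrix
  they leave row \<open>a\<close> zero, so the matrix is singular and has a kernel vector.\<close>

lemma exists_orthogonal_vector:
  fixes v :: "'n::finite \<Rightarrow> complex ^ 'n"
  assumes "a \<notin> S"
  shows "\<exists>x. x \<noteq> 0 \<and> (\<forall>i\<in>S. cip (v i) x = 0)"
proof -
  define M :: "'n cmat" where "M = (\<chi> i j. if i \<in> S then cnj (v i $ j) else 0)"
  have "\<not> (\<exists>B. B ** M = mat 1)"
  proof
    assume "\<exists>B. B ** M = mat 1"
    then obtain B where "M ** B = mat 1"
      using matrix_left_right_inverse by blast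
    then have "(M ** B) $ a $ a = 1"
      by (simp add: mat_def)
    then show False
      using assms by (simp add: M_def matrix_matrix_mult_def)
  qed
  then obtain x where x: "x \<noteq> 0" "M *v x = 0"
    using matrix_left_invertible_ker[of M] by blast
  have "cip (v i) x = 0" if "i \<in> S" for i
  proof -
    have "(M *v x) $ i = 0"
      using x by simp
    then show ?thesis
      using that by (simp add: M_def matrix_vector_mult_def cip_def)
  qed
  then show ?thesis
    using x by blast
qed

text \<open>The first-order condition at an extremum, used below for the Rayleigh quotient.\<close>

lemma linear_coeff_zero:
  fixes b c :: real
  assumes "\<And>t. 0 \<le> 2 * t * b + t\<^sup>2 * c"
  shows "b = 0"
proof (rule ccontr)
  assume "b \<noteq> 0"
  \<comment> \<open>At \<open>t = - b / k\<close> the polynomial equals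
    \<open>b^2 / k^2 * (c - 2 * k)\<close>, which is negative because \<open>k\<close> is positive
    and exceeds \<open>c\<close>.\<close>
  define k where "k = \<bar>c\<bar> + 1"
  have k: "k > 0" "c < k"
    by (auto simp: k_def)
  have "0 \<le> 2 * (- b / k) * b + (- b / k)\<^sup>2 * c"
    by (rule assms)
  also have "\<dots> = (b\<^sup>2 / k\<^sup>2) * (c - 2 * k)"
    using k by (simp add: field_simps power2_eq_square)
  also have "\<dots> < 0"
    using k \<open>b \<noteq> 0\<close> by (intro mult_pos_neg) auto
  finally show False
    by simp
qed

text \<open>A maximiser of the Rayleigh quotient on the orthogonal complement of given eigenvectors
  is a further eigenvector.\<close>

lemma exists_orthogonal_eigenvector:
  fixes A :: "'n::finite cmat" and v :: "'n \<Rightarrow> complex ^ 'n"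
  assumes A: "hermitian A" and a: "a \<notin> S"
    and v: "\<And>i. i \<in> S \<Longrightarrow> A *v v i = (d i :: real) *\<^sub>R v i"
  shows "\<exists>x l. x \<bullet> x = 1 \<and> (\<forall>i\<in>S. cip (v i) x = 0) \<and> A *v x = (l :: real) *\<^sub>R x"
proof -
  define W where "W = {x. \<forall>i\<in>S. cip (v i) x = 0}"
  have W_add: "x + y \<in> W" if "x \<in> W" "y \<in> W" for x y
    using that by (simp add: W_def cip_add_right)
  have W_scale: "r *\<^sub>R x \<in> W" if "x \<in> W" for r x
    using that by (simp add: W_def cip_scaleR_right)
  \<comment> \<open>A Hermitian \<open>A\<close> can be moved onto the eigenvector
    \<open>v i\<close>, which it only scales, so the orthogonal complement is invariant.\<close>
  have W_A: "A *v x \<in> W" if "x \<in> W" for x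
    using that A v by (simp add: W_def cip_adjoint[of _ A] hermitian_def cip_scaleR_left)
  obtain y where y: "y \<noteq> 0" "y \<in> W"
    using exists_orthogonal_vector[OF a, of v] by (auto simp: W_def)
  have "continuous_on UNIV (cip u)" for u :: "complex ^ 'n"
    unfolding cip_def by (intro continuous_intros)
  then have "closed {x. cip (v i) x = 0}" for i
    by (intro closed_Collect_eq) auto
  then have "closed W"
    unfolding W_def Collect_ball_eq by (intro closed_INT) auto
  then have "compact (sphere 0 1 \<inter> W)"
    by (intro compact_Int_closed) auto
  moreover have "(1 / norm y) *\<^sub>R y \<in> sphere 0 1 \<inter> W"
    using y W_scale by auto
  moreover have "continuous_on (sphere 0 1 \<inter> W) (\<lambda>x. x \<bullet> (A *v x))"
    unfolding inner_vec_def matrix_vector_mult_def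
    by (simp, intro continuous_intros)
  ultimately obtain x where x: "x \<in> W" "norm x = 1"
    and max: "\<And>z. z \<in> sphere 0 1 \<inter> W \<Longrightarrow> z \<bullet> (A *v z) \<le> x \<bullet> (A *v x)"
    using continuous_attains_sup[of "sphere 0 1 \<inter> W" "\<lambda>x. x \<bullet> (A *v x)"]
    by (metis IntE empty_iff mem_sphere_0)
  define l where "l = x \<bullet> (A *v x)"
  have xx: "x \<bullet> x = 1"
    using x by (simp add: dot_square_norm)
  have bound: "z \<bullet> (A *v z) \<le> l * (z \<bullet> z)" if "z \<in> W" for z
  proof (cases "z = 0")
    case False
    define u where "u = (1 / norm z) *\<^sub>R z"
    have zu: "z = norm z *\<^sub>R u" and "u \<in> sphere 0 1 \<inter> W"
      using False that W_scale by (auto simp: u_def)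
    then have "u \<bullet> (A *v u) \<le> l"
      using max l_def by blast
    then have "(norm z)\<^sup>2 * (u \<bullet> (A *v u)) \<le> (norm z)\<^sup>2 * l"
      by (intro mult_left_mono) auto
    moreover have "z \<bullet> (A *v z) = (norm z)\<^sup>2 * (u \<bullet> (A *v u))"
      by (subst (1 2) zu) (simp add: matrix_vector_scaleR power2_eq_square)
    ultimately show ?thesis
      by (simp add: dot_square_norm mult.commute)
  qed auto
  \<comment> \<open>The residual of the eigenvector equation. It lies in \<open>W\<close>, so
    maximality may be tested along \<open>x + t *\<^sub>R y\<close>; the coefficient of
    \<open>2 * t\<close> there is the squared norm of \<open>y\<close>, which must vanish.\<close>
  define y where "y = l *\<^sub>R x - A *v x"
  have yW: "y \<in> W"
    using W_add[OF W_scale[OF x(1), of l] W_scale[OF W_A[OF x(1)], of "-1"]] by (simp add: y_def)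
  have sym: "x \<bullet> (A *v y) = y \<bullet> (A *v x)"
    using A by (simp add: inner_adjoint[of x A y] hermitian_def inner_commute)
  have "y \<bullet> y = 0"
  proof (rule linear_coeff_zero)
    fix t :: real
    have "0 \<le> l * ((x + t *\<^sub>R y) \<bullet> (x + t *\<^sub>R y)) - (x + t *\<^sub>R y) \<bullet> (A *v (x + t *\<^sub>R y))"
      using bound[OF W_add[OF x(1) W_scale[OF yW, of t]]] by simp
    also have "\<dots> = 2 * t * (l * (x \<bullet> y) - y \<bullet> (A *v x)) + t\<^sup>2 * (l * (y \<bullet> y) - y \<bullet> (A *v y))"
      using sym xx by (simp add: inner_add_left inner_add_right matrix_vector_right_distrib
          matrix_vector_scaleR inner_commute[of y x] l_def[symmetric] algebra_simps power2_eq_square)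
    also have "l * (x \<bullet> y) - y \<bullet> (A *v x) = y \<bullet> y"
    proof -
      have "y \<bullet> y = y \<bullet> (l *\<^sub>R x - A *v x)"
        unfolding y_def by (rule refl)
      then show ?thesis
        by (simp add: inner_diff_right inner_commute[of x y])
    qed
    finally show "0 \<le> 2 * t * (y \<bullet> y) + t\<^sup>2 * (l * (y \<bullet> y) - y \<bullet> (A *v y))" .
  qed
  then have "A *v x = l *\<^sub>R x"
    by (simp add: y_def)
  then show ?thesis
    using x(1) xx by (auto simp: W_def)
qed

text \<open>Orthonormal eigenvectors are collected one index at a time; those for the whole index
  type form the columns of \<open>U\<close>.\<close>

theorem spectral_theorem:
  fixes A :: "'n::finite cmat"
  assumes A: "hermitian A"
  shows "\<exists>U d. unitary U \<and> A = U ** diag_mat d ** U\<^sup>\<dagger>"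
proof -
  have "\<exists>v d. (\<forall>i\<in>S. A *v v i = (d i :: real) *\<^sub>R v i) \<and>
          (\<forall>i\<in>S. \<forall>j\<in>S. cip (v i) (v j) = (if i = j then 1 else 0))" for S :: "'n set"
  proof (induction S rule: finite_induct[OF finite])
    case (2 a S)
    then obtain v and d :: "'n \<Rightarrow> real" where vd: "\<And>i. i \<in> S \<Longrightarrow> A *v v i = d i *\<^sub>R v i"
      and on: "\<And>i j. i \<in> S \<Longrightarrow> j \<in> S \<Longrightarrow> cip (v i) (v j) = (if i = j then 1 else 0)"
      by blast
    obtain x l where x: "x \<bullet> x = 1" "\<And>i. i \<in> S \<Longrightarrow> cip (v i) x = 0" "A *v x = l *\<^sub>R x"
      using exists_orthogonal_eigenvector[OF A 2(2), of v d] vd by blast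
    have "cip x (v i) = 0" if "i \<in> S" for i
      using x(2)[OF that] by (metis cip_commute complex_cnj_zero)
    moreover have "cip x x = 1"
      using x(1) by (simp add: cip_self)
    ultimately have "(\<forall>i\<in>insert a S. A *v (v(a := x)) i = (d(a := l)) i *\<^sub>R (v(a := x)) i) \<and>
       (\<forall>i\<in>insert a S. \<forall>j\<in>insert a S. cip ((v(a := x)) i) ((v(a := x)) j) = (if i = j then 1 else 0))"
      using x(2,3) vd on 2(2) by auto
    then show ?case
      by blast
  qed auto
  from this[of UNIV] obtain v and d :: "'n \<Rightarrow> real" where vd: "\<And>i. A *v v i = d i *\<^sub>R v i"
    and on: "\<And>i j. cip (v i) (v j) = (if i = j then 1 else 0)"
    by blast
  define U :: "'n cmat" where "U = (\<chi> i j. v j $ i)"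
  have 1: "U\<^sup>\<dagger> ** U = mat 1"
    using on by (simp add: U_def mat_adjoint_def matrix_matrix_mult_def mat_def cip_def vec_eq_iff)
  then have U: "unitary U"
    using matrix_left_right_inverse unfolding unitary_def by blast
  have "(A ** U) $ i $ j = (U ** diag_mat d) $ i $ j" for i j
  proof -
    have "(A ** U) $ i $ j = (A *v v j) $ i"
      by (simp add: U_def matrix_matrix_mult_def matrix_vector_mult_def)
    also have "\<dots> = (U ** diag_mat d) $ i $ j"
      by (simp add: vd U_def matrix_matrix_mult_def diag_mat_def if_distrib scaleR_conv_of_real[where 'a = complex]
          mult.commute cong: if_cong)
    finally show ?thesis .
  qed
  then have "A ** U = U ** diag_mat d"
    by (simp add: vec_eq_iff)
  then have "A = U ** diag_mat d ** U\<^sup>\<dagger>"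
    using U unfolding unitary_def by (metis matrix_mul_assoc matrix_mul_rid)
  then show ?thesis
    using U by blast
qed

text \<open>This makes the description in \<open>mat_fun\<close> well defined. The transition matrix
  \<open>W\<close> intertwines the two diagonals, so its entry at \<open>i\<close>, \<open>j\<close>
  is zero unless \<open>d j = e i\<close>; hence it also intertwines the diagonals after applying
  \<open>f\<close>.\<close>

lemma diagonalisation_fun_unique:
  fixes U V :: "'n::finite cmat"
  assumes U: "unitary U" and V: "unitary V"
    and eq: "U ** diag_mat d ** U\<^sup>\<dagger> = V ** diag_mat e ** V\<^sup>\<dagger>"
  shows "U ** diag_mat (\<lambda>i. f (d i)) ** U\<^sup>\<dagger> = V ** diag_mat (\<lambda>i. f (e i)) ** V\<^sup>\<dagger>"
proof -
  define W where "W = V\<^sup>\<dagger> ** U"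
  have "W ** diag_mat d = V\<^sup>\<dagger> ** (U ** diag_mat d ** U\<^sup>\<dagger>) ** U"
    using U by (simp add: W_def unitary_def flip: matrix_mul_assoc)
  also have "\<dots> = (V\<^sup>\<dagger> ** V) ** diag_mat e ** W"
    unfolding eq W_def by (simp only: matrix_mul_assoc)
  also have "\<dots> = diag_mat e ** W"
    using V by (simp add: unitary_def)
  finally have *: "W $ i $ j * d j = e i * W $ i $ j" for i j
    by (metis mult_diag_mat_entry)
  have "W $ i $ j * f (d j) = f (e i) * W $ i $ j" for i j
    using *[of i j] by (cases "W $ i $ j = 0") auto
  then have "W ** diag_mat (\<lambda>i. f (d i)) = diag_mat (\<lambda>i. f (e i)) ** W"
    by (simp add: vec_eq_iff mult_diag_mat_entry)
  then have "V ** (W ** diag_mat (\<lambda>i. f (d i))) ** U\<^sup>\<dagger> = V ** (diag_mat (\<lambda>i. f (e i)) ** W) ** U\<^sup>\<dagger>"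
    by simp
  moreover have "V ** (W ** D) ** U\<^sup>\<dagger> = (V ** V\<^sup>\<dagger>) ** U ** D ** U\<^sup>\<dagger>" for D
    unfolding W_def by (simp only: matrix_mul_assoc)
  moreover have "V ** (D ** W) ** U\<^sup>\<dagger> = V ** D ** V\<^sup>\<dagger> ** (U ** U\<^sup>\<dagger>)" for D
    unfolding W_def by (simp only: matrix_mul_assoc)
  ultimately show ?thesis
    using U V by (simp add: unitary_def)
qed

lemma mat_fun_diagonalisation:
  assumes "unitary U"
  shows "mat_fun f (U ** diag_mat d ** U\<^sup>\<dagger>) = U ** diag_mat (\<lambda>i. f (d i)) ** U\<^sup>\<dagger>"
  unfolding mat_fun_def
proof (rule the_equality)
  show "\<exists>V e. unitary V \<and> U ** diag_mat d ** U\<^sup>\<dagger> = V ** diag_mat e ** V\<^sup>\<dagger> \<and>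
      U ** diag_mat (\<lambda>i. f (d i)) ** U\<^sup>\<dagger> = V ** diag_mat (\<lambda>i. f (e i)) ** V\<^sup>\<dagger>"
    using assms by blast
next
  fix B
  assume "\<exists>V e. unitary V \<and> U ** diag_mat d ** U\<^sup>\<dagger> = V ** diag_mat e ** V\<^sup>\<dagger> \<and>
      B = V ** diag_mat (\<lambda>i. f (e i)) ** V\<^sup>\<dagger>"
  then show "B = U ** diag_mat (\<lambda>i. f (d i)) ** U\<^sup>\<dagger>"
    using diagonalisation_fun_unique[OF assms] by metis
qed

lemma unitary_mult:
  assumes "unitary U" "unitary V"
  shows "unitary (U ** V)"
proof -
  have "V\<^sup>\<dagger> ** U\<^sup>\<dagger> ** (U ** V) = V\<^sup>\<dagger> ** (U\<^sup>\<dagger> ** U) ** V" "U ** V ** (V\<^sup>\<dagger> ** U\<^sup>\<dagger>) = U ** (V ** V\<^sup>\<dagger>) ** U\<^sup>\<dagger>"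
    by (simp_all only: matrix_mul_assoc)
  then show ?thesis
    using assms by (simp add: unitary_def adjoint_mult)
qed

lemma unitary_conj_diag_mat_mult:
  assumes "unitary U"
  shows "(U ** diag_mat d ** U\<^sup>\<dagger>) ** (U ** diag_mat e ** U\<^sup>\<dagger>) = U ** diag_mat (\<lambda>i. d i * e i) ** U\<^sup>\<dagger>"
proof -
  have "(U ** diag_mat d ** U\<^sup>\<dagger>) ** (U ** diag_mat e ** U\<^sup>\<dagger>)
      = U ** (diag_mat d ** (U\<^sup>\<dagger> ** U) ** diag_mat e) ** U\<^sup>\<dagger>"
    by (simp only: matrix_mul_assoc)
  then show ?thesis
    using assms by (simp add: unitary_def diag_mat_mult)
qed

lemma diag_entry_eq_inner:
  "d i = axis i 1 \<bullet> (diag_mat d *v axis i (1 :: complex))"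
proof -
  have "axis i 1 \<bullet> (diag_mat d *v axis i (1 :: complex)) = (\<Sum>j\<in>UNIV. if j = i then d i else 0)"
    unfolding inner_diag_mat by (rule sum.cong) (auto simp: axis_def)
  then show ?thesis
    by simp
qed

text \<open>Each diagonal entry is a value of the quadratic form, at the preimage of a unit vector
  under the adjoint of \<open>S\<close>. Signs of \<open>d\<close> thus follow from definiteness,
  even if \<open>S\<close> is not unitary.\<close>

lemma conj_diag_mat_entry:
  fixes T S :: "'n::finite cmat"
  assumes "T ** S = mat 1"
  shows "d i = (T\<^sup>\<dagger> *v axis i 1) \<bullet> ((S ** diag_mat d ** S\<^sup>\<dagger>) *v (T\<^sup>\<dagger> *v axis i 1))"
proof -
  have "S\<^sup>\<dagger> ** T\<^sup>\<dagger> = mat 1"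
    using assms by (simp flip: adjoint_mult)
  then have "S\<^sup>\<dagger> *v (T\<^sup>\<dagger> *v axis i 1) = (axis i 1 :: complex ^ 'n)"
    by (simp add: matrix_vector_mul_assoc)
  then show ?thesis
    by (simp add: inner_congruence flip: diag_entry_eq_inner)
qed

lemma conj_diag_mat_pos:
  fixes T S :: "'n::finite cmat"
  assumes TS: "T ** S = mat 1" and pd: "pos_def (S ** diag_mat d ** S\<^sup>\<dagger>)"
  shows "0 < d i"
proof -
  have "S\<^sup>\<dagger> ** T\<^sup>\<dagger> = mat 1"
    using TS by (simp flip: adjoint_mult)
  then have "S\<^sup>\<dagger> *v (T\<^sup>\<dagger> *v axis i 1) = (axis i 1 :: complex ^ 'n)"
    by (simp add: matrix_vector_mul_assoc)
  then have "T\<^sup>\<dagger> *v axis i 1 \<noteq> (0 :: complex ^ 'n)"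
    by (metis axis_eq_0_iff matrix_vector_mult_0_right zero_neq_one)
  then show ?thesis
    using pd conj_diag_mat_entry[OF TS, of d i] by (simp add: pos_def_iff)
qed

lemma conj_diag_mat_nonneg:
  fixes T S :: "'n::finite cmat"
  assumes TS: "T ** S = mat 1" and psd: "pos_semidef (S ** diag_mat d ** S\<^sup>\<dagger>)"
  shows "0 \<le> d i"
  using psd conj_diag_mat_entry[OF TS, of d i] by (simp add: pos_semidef_iff)

lemma pos_semidef_conj_diag_mat:
  assumes "\<And>i. 0 \<le> d i"
  shows "pos_semidef (S ** diag_mat d ** S\<^sup>\<dagger>)"
  using assms by (auto simp: pos_semidef_iff hermitian_mult_adjoint inner_congruence inner_diag_mat
      intro!: sum_nonneg)

lemma pos_def_congruence:
  assumes "pos_def C" "T ** S = mat 1"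
  shows "pos_def (S ** C ** S\<^sup>\<dagger>)"
  unfolding pos_def_iff
proof (intro conjI allI impI)
  show "hermitian (S ** C ** S\<^sup>\<dagger>)"
    using assms by (simp add: pos_def_iff hermitian_mult_adjoint)
  fix x :: "complex ^ 'a"
  assume "x \<noteq> 0"
  have "S ** T = mat 1"
    using assms matrix_left_right_inverse by blast
  then have "T\<^sup>\<dagger> ** S\<^sup>\<dagger> = mat 1"
    by (simp flip: adjoint_mult)
  then have "S\<^sup>\<dagger> *v x \<noteq> 0"
    using \<open>x \<noteq> 0\<close> by (metis matrix_left_invertible_ker)
  then show "0 < x \<bullet> ((S ** C ** S\<^sup>\<dagger>) *v x)"
    using assms by (simp add: pos_def_iff inner_congruence)
qed

section \<open>Geometric means of positive definite matrices\<close>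

text \<open>Two positive definite matrices are simultaneously diagonalised by a congruence, and all
  their weighted means are diagonal in the same coordinates.\<close>

lemma geo_mean_pd_diagonalisation:
  fixes A C :: "'n::finite cmat"
  assumes A: "pos_def A" and C: "pos_def C"
  obtains S T c where "T ** S = mat 1" "\<And>i. 0 < c i" "A = S ** S\<^sup>\<dagger>" "C = S ** diag_mat c ** S\<^sup>\<dagger>"
    "\<And>t. geo_mean_pd t A C = S ** diag_mat (\<lambda>i. c i powr t) ** S\<^sup>\<dagger>"
proof -
  obtain V a where V: "unitary V" and Aeq: "A = V ** diag_mat a ** V\<^sup>\<dagger>"
    using A spectral_theorem unfolding pos_def_iff by blast
  have a: "0 < a i" for i
    using conj_diag_mat_pos[of "V\<^sup>\<dagger>" V a] V A Aeq by (simp add: unitary_def)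
  define R where "R = V ** diag_mat (\<lambda>i. a i powr (1/2)) ** V\<^sup>\<dagger>"
  define R' where "R' = V ** diag_mat (\<lambda>i. a i powr (-1/2)) ** V\<^sup>\<dagger>"
  have powr: "mat_powr A (1/2) = R" "mat_powr A (-1/2) = R'"
    unfolding Aeq mat_powr_def R_def R'_def by (rule mat_fun_diagonalisation[OF V])+
  have herm: "R\<^sup>\<dagger> = R" "R'\<^sup>\<dagger> = R'"
    by (simp_all add: R_def R'_def adjoint_mult matrix_mul_assoc)
  have "a i powr (1/2) * a i powr (1/2) = a i" "a i powr (1/2) * a i powr (-1/2) = 1"
    "a i powr (-1/2) * a i powr (1/2) = 1" for i
    using a[of i] by (simp_all flip: powr_add)
  then have RR: "R ** R = A" "R ** R' = mat 1" "R' ** R = mat 1"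
    using V by (simp_all add: R_def R'_def unitary_conj_diag_mat_mult Aeq unitary_def)
  have "pos_def (R' ** C ** R'\<^sup>\<dagger>)"
    using pos_def_congruence[OF C RR(2)] .
  then have K: "pos_def (R' ** C ** R')"
    by (simp add: herm)
  then obtain W c where W: "unitary W" and Keq: "R' ** C ** R' = W ** diag_mat c ** W\<^sup>\<dagger>"
    using spectral_theorem unfolding pos_def_iff by blast
  have c: "0 < c i" for i
    using conj_diag_mat_pos[of "W\<^sup>\<dagger>" W c] W K Keq by (simp add: unitary_def)
  \<comment> \<open>\<open>R\<close> and \<open>R'\<close> are the powers 1/2 and -1/2 of
    \<open>A\<close>, and \<open>W\<close> diagonalises the inner matrix in the definition of the
    mean. Raising that matrix to the power \<open>t\<close> changes only its diagonal, so one
    \<open>S\<close> serves every \<open>t\<close>.\<close>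
  define S where "S = R ** W"
  have Sadj: "S\<^sup>\<dagger> = W\<^sup>\<dagger> ** R"
    by (simp add: S_def adjoint_mult herm)
  show ?thesis
  proof (rule that)
    have "W\<^sup>\<dagger> ** R' ** S = W\<^sup>\<dagger> ** (R' ** R) ** W"
      unfolding S_def by (simp only: matrix_mul_assoc)
    then show "W\<^sup>\<dagger> ** R' ** S = mat 1"
      using W by (simp add: RR unitary_def)
    have "S ** S\<^sup>\<dagger> = R ** (W ** W\<^sup>\<dagger>) ** R"
      unfolding Sadj by (simp only: S_def matrix_mul_assoc)
    then show "A = S ** S\<^sup>\<dagger>"
      using W by (simp add: RR unitary_def)
    have "S ** diag_mat c ** S\<^sup>\<dagger> = R ** (R' ** C ** R') ** R"
      unfolding Sadj Keq by (simp only: S_def matrix_mul_assoc)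
    also have "\<dots> = (R ** R') ** C ** (R' ** R)"
      by (simp only: matrix_mul_assoc)
    finally show "C = S ** diag_mat c ** S\<^sup>\<dagger>"
      by (simp add: RR)
    show "geo_mean_pd t A C = S ** diag_mat (\<lambda>i. c i powr t) ** S\<^sup>\<dagger>" for t
      unfolding geo_mean_pd_def powr Sadj Keq unfolding mat_powr_def mat_fun_diagonalisation[OF W]
      by (simp only: S_def matrix_mul_assoc)
  qed (rule c)
qed

section \<open>Block positivity and the extremal property of the geometric mean\<close>

text \<open>The quadratic form at the pair \<open>x\<close>, \<open>y\<close> of the block matrix
  with diagonal blocks \<open>P\<close>, \<open>Q\<close> and off-diagonal blocks \<open>G\<close>
  and its adjoint. The two cross terms have the same real part, hence the factor 2.\<close>

definition block_nonneg :: "'n::finite cmat \<Rightarrow> 'n cmat \<Rightarrow> 'n cmat \<Rightarrow> bool" where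
  "block_nonneg P G Q \<longleftrightarrow>
     (\<forall>x y. 0 \<le> x \<bullet> (P *v x) + 2 * (x \<bullet> (G *v y)) + y \<bullet> (Q *v y))"

lemma block_nonneg_mono:
  assumes "block_nonneg P G Q" "P \<preceq> P'" "Q \<preceq> Q'"
  shows "block_nonneg P' G Q'"
  unfolding block_nonneg_def
proof (intro allI)
  fix x y
  show "0 \<le> x \<bullet> (P' *v x) + 2 * (x \<bullet> (G *v y)) + y \<bullet> (Q' *v y)"
    using assms(1)[unfolded block_nonneg_def, rule_format, of x y]
      loewner_leD[OF assms(2), of x] loewner_leD[OF assms(3), of y] by linarith
qed

lemma block_nonneg_congruence:
  "block_nonneg P G Q \<Longrightarrow> block_nonneg (R ** P ** R\<^sup>\<dagger>) (R ** G ** S\<^sup>\<dagger>) (S ** Q ** S\<^sup>\<dagger>)"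
  by (simp add: block_nonneg_def inner_congruence)

text \<open>In each coordinate the form is the squared modulus of
  \<open>sqrt (p i) *\<^sub>R x $ i + sqrt (q i) *\<^sub>R y $ i\<close>.\<close>

lemma block_nonneg_diag:
  assumes "\<And>i. 0 \<le> p i" "\<And>i. 0 \<le> q i"
  shows "block_nonneg (diag_mat p) (diag_mat (\<lambda>i. sqrt (p i * q i))) (diag_mat q)"
  unfolding block_nonneg_def
proof (intro allI)
  fix x y :: "complex ^ 'a"
  have "x \<bullet> (diag_mat p *v x) + 2 * (x \<bullet> (diag_mat (\<lambda>i. sqrt (p i * q i)) *v y)) + y \<bullet> (diag_mat q *v y)
     = (\<Sum>i\<in>UNIV. p i * (x $ i \<bullet> x $ i) + 2 * sqrt (p i * q i) * (x $ i \<bullet> y $ i) + q i * (y $ i \<bullet> y $ i))"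
    by (simp add: inner_vec_def diag_mat_mult_vec sum_distrib_left flip: sum.distrib)
       (simp add: mult_ac)
  also have "\<dots> = (\<Sum>i\<in>UNIV. (sqrt (p i) *\<^sub>R x $ i + sqrt (q i) *\<^sub>R y $ i) \<bullet> (sqrt (p i) *\<^sub>R x $ i + sqrt (q i) *\<^sub>R y $ i))"
  proof (rule sum.cong[OF refl])
    fix i
    have "sqrt (p i) * (sqrt (p i) * z) = p i * z" "sqrt (q i) * (sqrt (q i) * z) = q i * z" for z
      using assms by (simp_all flip: mult.assoc)
    then show "p i * (x $ i \<bullet> x $ i) + 2 * sqrt (p i * q i) * (x $ i \<bullet> y $ i) + q i * (y $ i \<bullet> y $ i)
      = (sqrt (p i) *\<^sub>R x $ i + sqrt (q i) *\<^sub>R y $ i) \<bullet> (sqrt (p i) *\<^sub>R x $ i + sqrt (q i) *\<^sub>R y $ i)"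
      by (simp only: inner_add_left inner_add_right inner_scaleR_left inner_scaleR_right
          inner_commute[of "y $ i" "x $ i"] real_sqrt_mult distrib_left) (simp add: mult_ac)
  qed
  also have "\<dots> \<ge> 0"
    by (intro sum_nonneg) simp
  finally show "0 \<le> x \<bullet> (diag_mat p *v x) + 2 * (x \<bullet> (diag_mat (\<lambda>i. sqrt (p i * q i)) *v y)) + y \<bullet> (diag_mat q *v y)" .
qed

text \<open>Positivity of the block matrix gives \<open>H\<^sup>2 \<le> D\<close>; operator monotonicity of the square root is
  seen at an eigenvector of \<open>H - D\<^bsup>1/2\<^esup>\<close>.\<close>

lemma block_nonneg_imp_le_sqrt_diag:
  fixes H :: "'n::finite cmat"
  assumes bl: "block_nonneg (mat 1) H (diag_mat c)" and H: "hermitian H" and c: "\<And>i. 0 \<le> c i"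
  shows "H \<preceq> diag_mat (\<lambda>i. sqrt (c i))"
proof -
  define E where "E = (diag_mat (\<lambda>i. sqrt (c i)) :: 'n cmat)"
  have E: "hermitian E"
    by (simp add: E_def)
  have bound: "(H *v y) \<bullet> (H *v y) \<le> (E *v y) \<bullet> (E *v y)" for y
  proof -
    have "E ** E = diag_mat c"
      using c by (simp add: E_def diag_mat_mult)
    then have "(E *v y) \<bullet> (E *v y) = y \<bullet> (diag_mat c *v y)"
      using E inner_adjoint[of y E "E *v y"] by (simp add: hermitian_def matrix_vector_mul_assoc)
    \<comment> \<open>For fixed \<open>y\<close> the form is smallest at this first vector;
      inserting it amounts to taking the Schur complement.\<close>
    moreover have "0 \<le> (- (H *v y)) \<bullet> (mat 1 *v (- (H *v y))) + 2 * ((- (H *v y)) \<bullet> (H *v y)) + y \<bullet> (diag_mat c *v y)"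
      using bl unfolding block_nonneg_def by blast
    ultimately show ?thesis
      by simp
  qed
  have "hermitian (H - E)"
    using H E by (simp add: hermitian_def adjoint_diff)
  then obtain V l where V: "unitary V" and eq: "H - E = V ** diag_mat l ** V\<^sup>\<dagger>"
    using spectral_theorem by blast
  have l: "l i \<le> 0" for i
  proof (rule ccontr)
    assume "\<not> l i \<le> 0"
    define x where "x = V *v axis i 1"
    have "V\<^sup>\<dagger> *v x = axis i 1"
      using V by (simp add: x_def matrix_vector_mul_assoc unitary_def)
    then have 1: "x \<bullet> x = 1"
      using inner_adjoint[of x V "axis i 1"] by (simp add: inner_axis_axis flip: x_def)
    have "diag_mat l *v axis i 1 = l i *\<^sub>R (axis i 1 :: complex ^ 'n)"
      by (auto simp: vec_eq_iff diag_mat_mult_vec axis_def)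
    then have "(H - E) *v x = l i *\<^sub>R x"
      unfolding eq using \<open>V\<^sup>\<dagger> *v x = axis i 1\<close>
      by (simp add: matrix_vector_scaleR x_def flip: matrix_vector_mul_assoc)
    then have Hx: "H *v x = E *v x + l i *\<^sub>R x"
      by (simp add: matrix_vector_mult_diff_rdistrib algebra_simps)
    have "0 \<le> x \<bullet> (E *v x)"
      using c by (auto simp: E_def inner_diag_mat intro!: sum_nonneg)
    \<comment> \<open>This is the excess of the squared norm of \<open>H *v x\<close> over that of
      \<open>E *v x\<close>; a positive eigenvalue of the difference would contradict
      \<open>bound\<close>.\<close>
    then have "0 < l i * (2 * (x \<bullet> (E *v x)) + l i)"
      using \<open>\<not> l i \<le> 0\<close> by (intro mult_pos_pos) auto
    moreover have "(H *v x) \<bullet> (H *v x) = (E *v x) \<bullet> (E *v x) + l i * (2 * (x \<bullet> (E *v x)) + l i)"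
      unfolding Hx using 1 by (simp add: inner_add_left inner_add_right inner_commute[of "E *v x" x] algebra_simps)
    ultimately show False
      using bound[of x] by linarith
  qed
  have "x \<bullet> (H *v x) \<le> x \<bullet> (E *v x)" for x
  proof -
    have "x \<bullet> ((H - E) *v x) \<le> 0"
      unfolding eq inner_congruence inner_diag_mat
      using l by (intro sum_nonpos mult_nonpos_nonneg) auto
    then show ?thesis
      by (simp add: matrix_vector_mult_diff_rdistrib inner_diff_right)
  qed
  then show ?thesis
    using loewner_leI H E unfolding E_def by blast
qed

lemma loewner_le_congruence:
  assumes "A \<preceq> B"
  shows "S ** A ** S\<^sup>\<dagger> \<preceq> S ** B ** S\<^sup>\<dagger>"
proof -
  have "S ** B ** S\<^sup>\<dagger> - S ** A ** S\<^sup>\<dagger> = S ** (B - A) ** S\<^sup>\<dagger>"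
    by (simp add: matrix_mult_diff_left matrix_mult_diff_right)
  then show ?thesis
    using assms by (simp add: loewner_le_def pos_semidef_iff hermitian_mult_adjoint inner_congruence)
qed

text \<open>Congruence by \<open>T\<close>, the inverse of \<open>S\<close>, turns the first block
  into the identity and the second into a diagonal matrix; congruence by \<open>S\<close> carries
  the resulting bound back.\<close>

lemma block_nonneg_imp_le_sqrt_congruence:
  fixes S :: "'n::finite cmat"
  assumes TS: "T ** S = mat 1" and c: "\<And>i. 0 \<le> c i" and G: "hermitian G"
    and bl: "block_nonneg (S ** S\<^sup>\<dagger>) G (S ** diag_mat c ** S\<^sup>\<dagger>)"
  shows "G \<preceq> S ** diag_mat (\<lambda>i. sqrt (c i)) ** S\<^sup>\<dagger>"
proof -
  have ST: "S ** T = mat 1"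
    using TS matrix_left_right_inverse by blast
  have adj: "S\<^sup>\<dagger> ** T\<^sup>\<dagger> = mat 1" "T\<^sup>\<dagger> ** S\<^sup>\<dagger> = mat 1"
    using TS ST by (simp_all flip: adjoint_mult)
  define H where "H = T ** G ** T\<^sup>\<dagger>"
  have "T ** (S ** S\<^sup>\<dagger>) ** T\<^sup>\<dagger> = (T ** S) ** (S\<^sup>\<dagger> ** T\<^sup>\<dagger>)"
    "T ** (S ** diag_mat c ** S\<^sup>\<dagger>) ** T\<^sup>\<dagger> = (T ** S) ** diag_mat c ** (S\<^sup>\<dagger> ** T\<^sup>\<dagger>)"
    by (simp_all only: matrix_mul_assoc)
  then have "block_nonneg (mat 1) H (diag_mat c)"
    using block_nonneg_congruence[OF bl, of T T] by (simp add: TS adj H_def)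
  moreover have "hermitian H"
    unfolding H_def using G by (rule hermitian_mult_adjoint)
  ultimately have "H \<preceq> diag_mat (\<lambda>i. sqrt (c i))"
    using c by (rule block_nonneg_imp_le_sqrt_diag)
  then have "S ** H ** S\<^sup>\<dagger> \<preceq> S ** diag_mat (\<lambda>i. sqrt (c i)) ** S\<^sup>\<dagger>"
    by (rule loewner_le_congruence)
  moreover have "S ** H ** S\<^sup>\<dagger> = (S ** T) ** G ** (T\<^sup>\<dagger> ** S\<^sup>\<dagger>)"
    unfolding H_def by (simp only: matrix_mul_assoc)
  ultimately show ?thesis
    by (simp add: ST adj)
qed

text \<open>Absorbing the square roots of \<open>p\<close> into \<open>S\<close> leaves the diagonal
  \<open>q i / p i\<close> in the second block, and \<open>p i * sqrt (q i / p i)\<close> is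
  \<open>sqrt (p i * q i)\<close>.\<close>

lemma block_nonneg_imp_le_sqrt_mult:
  fixes S :: "'n::finite cmat"
  assumes TS: "T ** S = mat 1" and p: "\<And>i. 0 < p i" and q: "\<And>i. 0 < q i" and G: "hermitian G"
    and bl: "block_nonneg (S ** diag_mat p ** S\<^sup>\<dagger>) G (S ** diag_mat q ** S\<^sup>\<dagger>)"
  shows "G \<preceq> S ** diag_mat (\<lambda>i. sqrt (p i * q i)) ** S\<^sup>\<dagger>"
proof -
  define r where "r = (\<lambda>i. sqrt (p i))"
  have r: "r i > 0" "r i * r i = p i" for i
    using p[of i] by (simp_all add: r_def)
  define S' where "S' = S ** diag_mat r"
  have conj: "S' ** diag_mat f ** S'\<^sup>\<dagger> = S ** diag_mat (\<lambda>i. p i * f i) ** S\<^sup>\<dagger>" for f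
  proof -
    have "S' ** diag_mat f ** S'\<^sup>\<dagger> = S ** (diag_mat r ** diag_mat f ** diag_mat r) ** S\<^sup>\<dagger>"
      unfolding S'_def adjoint_mult adjoint_diag_mat by (simp only: matrix_mul_assoc)
    also have "diag_mat r ** diag_mat f ** diag_mat r = (diag_mat (\<lambda>i. p i * f i) :: 'n cmat)"
      unfolding diag_mat_mult r(2)[symmetric] by (simp add: mult_ac)
    finally show ?thesis .
  qed
  have "diag_mat (\<lambda>i. 1 / r i) ** T ** S' = diag_mat (\<lambda>i. 1 / r i) ** (T ** S) ** diag_mat r"
    unfolding S'_def by (simp only: matrix_mul_assoc)
  also have "\<dots> = mat 1"
    using r(1) less_imp_neq[OF r(1)] by (simp add: TS diag_mat_mult)
  finally have inv: "diag_mat (\<lambda>i. 1 / r i) ** T ** S' = mat 1" .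
  have 1: "S' ** S'\<^sup>\<dagger> = S ** diag_mat p ** S\<^sup>\<dagger>"
    using conj[of "\<lambda>i. 1"] by simp
  have 2: "S' ** diag_mat (\<lambda>i. q i / p i) ** S'\<^sup>\<dagger> = S ** diag_mat q ** S\<^sup>\<dagger>"
    using p less_imp_neq[OF p] by (simp add: conj)
  have "p i * sqrt (q i / p i) = sqrt (p i * q i)" for i
    using p[of i] q[of i] by (simp add: real_sqrt_divide real_sqrt_mult real_div_sqrt field_simps)
  then have 3: "S' ** diag_mat (\<lambda>i. sqrt (q i / p i)) ** S'\<^sup>\<dagger> = S ** diag_mat (\<lambda>i. sqrt (p i * q i)) ** S\<^sup>\<dagger>"
    by (simp add: conj)
  have "G \<preceq> S' ** diag_mat (\<lambda>i. sqrt (q i / p i)) ** S'\<^sup>\<dagger>"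
    using p q bl by (intro block_nonneg_imp_le_sqrt_congruence[OF inv _ G])
      (auto simp: 1 2 intro: divide_nonneg_pos less_imp_le)
  then show ?thesis
    by (simp only: 3)
qed

lemma geo_mean_pd_0:
  assumes "pos_def A" "pos_def C"
  shows "geo_mean_pd 0 A C = A"
proof -
  obtain S T c where "\<And>i. 0 < c i" "A = S ** S\<^sup>\<dagger>"
    and gm: "geo_mean_pd 0 A C = S ** diag_mat (\<lambda>i. c i powr 0) ** S\<^sup>\<dagger>"
    using geo_mean_pd_diagonalisation[OF assms] by metis
  then show ?thesis
    by (simp add: less_imp_neq[THEN not_sym])
qed

lemma geo_mean_pd_1:
  assumes "pos_def A" "pos_def C"
  shows "geo_mean_pd 1 A C = C"
proof -
  obtain S T c where "\<And>i. 0 < c i" "C = S ** diag_mat c ** S\<^sup>\<dagger>"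
    and gm: "geo_mean_pd 1 A C = S ** diag_mat (\<lambda>i. c i powr 1) ** S\<^sup>\<dagger>"
    using geo_mean_pd_diagonalisation[OF assms] by metis
  then show ?thesis
    by (simp add: less_imp_le)
qed

lemma pos_semidef_geo_mean_pd:
  assumes "pos_def A" "pos_def C"
  shows "pos_semidef (geo_mean_pd t A C)"
proof -
  obtain S T c where "geo_mean_pd t A C = S ** diag_mat (\<lambda>i. c i powr t) ** S\<^sup>\<dagger>"
    using geo_mean_pd_diagonalisation[OF assms] by metis
  then show ?thesis
    by (simp add: pos_semidef_conj_diag_mat)
qed

lemma sqrt_powr_mult_powr:
  assumes "0 < (c :: real)"
  shows "sqrt (c powr s * c powr t) = c powr ((s + t) / 2)"
proof -
  have "sqrt (c powr s * c powr t) = (c powr (s + t)) powr (1/2)"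
    by (simp add: powr_half_sqrt powr_add)
  then show ?thesis
    by (simp add: powr_powr)
qed

text \<open>In common coordinates all three blocks are diagonal, and the entry with the averaged
  exponent is the scalar geometric mean of the other two.\<close>

lemma block_nonneg_geo_mean_pd:
  assumes "pos_def A" "pos_def C"
  shows "block_nonneg (geo_mean_pd s A C) (geo_mean_pd ((s + t) / 2) A C) (geo_mean_pd t A C)"
proof -
  obtain S T c where c: "\<And>i. 0 < c i"
    and gm: "\<And>t. geo_mean_pd t A C = S ** diag_mat (\<lambda>i. c i powr t) ** S\<^sup>\<dagger>"
    using geo_mean_pd_diagonalisation[OF assms] by metis
  have "block_nonneg (diag_mat (\<lambda>i. c i powr s)) (diag_mat (\<lambda>i. sqrt (c i powr s * c i powr t)))
      (diag_mat (\<lambda>i. c i powr t))"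
    by (rule block_nonneg_diag) auto
  then show ?thesis
    unfolding gm sqrt_powr_mult_powr[OF c] by (rule block_nonneg_congruence)
qed

lemma block_nonneg_imp_le_geo_mean_pd:
  assumes P: "pos_def P" and Q: "pos_def Q" and G: "hermitian G" and bl: "block_nonneg P G Q"
  shows "G \<preceq> geo_mean_pd (1/2) P Q"
proof -
  obtain S T c where TS: "T ** S = mat 1" and c: "\<And>i. 0 < c i" and PQ: "P = S ** S\<^sup>\<dagger>" "Q = S ** diag_mat c ** S\<^sup>\<dagger>"
    and gm: "\<And>t. geo_mean_pd t P Q = S ** diag_mat (\<lambda>i. c i powr t) ** S\<^sup>\<dagger>"
    using geo_mean_pd_diagonalisation[OF P Q] by metis
  have "G \<preceq> S ** diag_mat (\<lambda>i. sqrt (c i)) ** S\<^sup>\<dagger>"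
    using block_nonneg_imp_le_sqrt_congruence[OF TS _ G] c bl unfolding PQ by (simp add: less_imp_le)
  then show ?thesis
    unfolding gm using c by (simp add: powr_half_sqrt less_imp_le)
qed

section \<open>Monotonicity of the weighted means\<close>

text \<open>If \<open>t\<close> were missing, closedness would give nearest elements of
  \<open>T\<close> on both sides of it, and their midpoint would be an element inside the
  gap.\<close>

lemma midpoint_closed_set_unit_interval:
  fixes T :: "real set"
  assumes T: "closed T" "0 \<in> T" "1 \<in> T" and mid: "\<And>s t. s \<in> T \<Longrightarrow> t \<in> T \<Longrightarrow> (s + t) / 2 \<in> T"
    and t: "0 \<le> t" "t \<le> 1"
  shows "t \<in> T"
proof (rule ccontr)
  assume nt: "t \<notin> T"
  define a b where "a = Sup (T \<inter> {..t})" and "b = Inf (T \<inter> {t..})"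
  have "a \<in> T \<inter> {..t}"
    unfolding a_def using T t by (intro closed_contains_Sup) auto
  moreover have "b \<in> T \<inter> {t..}"
    unfolding b_def using T t by (intro closed_contains_Inf) auto
  ultimately have ab: "a \<in> T" "b \<in> T" "a < t" "t < b"
    using nt by (auto simp: less_le)
  define m where "m = (a + b) / 2"
  have m: "m \<in> T" "a < m" "m < b"
    using mid[OF ab(1,2)] ab by (auto simp: m_def)
  show False
  proof (cases "m \<le> t")
    case True
    then have "m \<le> a"
      unfolding a_def using m by (intro cSup_upper) auto
    then show False
      using m by simp
  next
    case False
    then have "b \<le> m"
      unfolding b_def using m by (intro cInf_lower) auto
    then show False
      using m by simp
  qed
qed

lemma continuous_on_geo_mean_pd_quad:
  assumes "pos_def A" "pos_def C"
  shows "continuous_on UNIV (\<lambda>t. x \<bullet> (geo_mean_pd t A C *v x))"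
proof -
  obtain S T c where c: "\<And>i. 0 < c i"
    and gm: "\<And>t. geo_mean_pd t A C = S ** diag_mat (\<lambda>i. c i powr t) ** S\<^sup>\<dagger>"
    using geo_mean_pd_diagonalisation[OF assms] by metis
  show ?thesis
    unfolding gm inner_congruence inner_diag_mat
    using less_imp_neq[OF c] by (intro continuous_intros) auto
qed

text \<open>The exponents for which monotonicity holds form a closed set, which contains the midpoint
  of any two of its elements by the extremal property of the geometric mean.\<close>

lemma geo_mean_pd_mono:
  assumes pd: "pos_def A" "pos_def C" "pos_def A'" "pos_def C'"
    and le: "A \<preceq> A'" "C \<preceq> C'" and t: "0 \<le> t" "t \<le> 1"
  shows "geo_mean_pd t A C \<preceq> geo_mean_pd t A' C'"
proof -
  define T where "T = {t. geo_mean_pd t A C \<preceq> geo_mean_pd t A' C'}"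
  have herm: "hermitian (geo_mean_pd t A C)" "hermitian (geo_mean_pd t A' C')" for t
    using pos_semidef_geo_mean_pd pd by (auto simp: pos_semidef_iff)
  \<comment> \<open>For fixed \<open>x\<close> the condition compares two continuous functions of
    the exponent, so \<open>T\<close> is an intersection of closed sets.\<close>
  have "T = (\<Inter>x. {t. x \<bullet> (geo_mean_pd t A C *v x) \<le> x \<bullet> (geo_mean_pd t A' C' *v x)})"
    using loewner_leI[OF herm] loewner_leD by (auto simp: T_def)
  then have "closed T"
    using pd by (auto intro!: closed_INT closed_Collect_le continuous_on_geo_mean_pd_quad)
  moreover have "0 \<in> T" "1 \<in> T"
    using le by (simp_all add: T_def geo_mean_pd_0 geo_mean_pd_1 pd)
  moreover have "(s + t) / 2 \<in> T" if "s \<in> T" "t \<in> T" for s t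
  proof -
    obtain S V c where VS: "V ** S = mat 1" and c: "\<And>i. 0 < c i"
      and gm: "\<And>t. geo_mean_pd t A' C' = S ** diag_mat (\<lambda>i. c i powr t) ** S\<^sup>\<dagger>"
      using geo_mean_pd_diagonalisation[OF pd(3,4)] by metis
    \<comment> \<open>The middle block belongs to the smaller pair, while the outer blocks are
      enlarged by the hypotheses at \<open>s\<close> and \<open>t\<close>. The extremal property in
      coordinates adapted to \<open>A'\<close> and \<open>C'\<close> then bounds the middle
      block.\<close>
    have "block_nonneg (geo_mean_pd s A' C') (geo_mean_pd ((s + t) / 2) A C) (geo_mean_pd t A' C')"
      using block_nonneg_mono[OF block_nonneg_geo_mean_pd[OF pd(1,2)]] that by (simp add: T_def)
    then have "geo_mean_pd ((s + t) / 2) A C \<preceq> S ** diag_mat (\<lambda>i. sqrt (c i powr s * c i powr t)) ** S\<^sup>\<dagger>"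
      unfolding gm using c less_imp_neq[OF c]
      by (intro block_nonneg_imp_le_sqrt_mult[OF VS _ _ herm(1)]) auto
    then show ?thesis
      by (simp add: T_def gm sqrt_powr_mult_powr[OF c])
  qed
  ultimately have "t \<in> T"
    using t by (rule midpoint_closed_set_unit_interval)
  then show ?thesis
    by (simp add: T_def)
qed

section \<open>Limits and positive semidefinite matrices\<close>

lemma tendsto_inner_matrix_vector:
  fixes F :: "'b \<Rightarrow> 'n::finite cmat"
  assumes "(F \<longlongrightarrow> L) net"
  shows "((\<lambda>e. x \<bullet> (F e *v y)) \<longlongrightarrow> x \<bullet> (L *v y)) net"
  unfolding inner_vec_def matrix_vector_mult_def
  by (simp, intro tendsto_intros assms)

text \<open>The limit is the infimum over positive arguments, which is finite by
  nonnegativity.\<close>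

lemma tendsto_mono_at_right_0:
  fixes f :: "real \<Rightarrow> real"
  assumes mono: "\<And>e d. 0 < e \<Longrightarrow> e \<le> d \<Longrightarrow> f e \<le> f d" and nonneg: "\<And>e. 0 < e \<Longrightarrow> 0 \<le> f e"
  shows "\<exists>l. (f \<longlongrightarrow> l) (at_right 0)"
proof -
  define l where "l = (INF e\<in>{0<..}. f e)"
  have bdd: "bdd_below (f ` {0<..})"
    using nonneg by (auto intro!: bdd_belowI)
  have "(f \<longlongrightarrow> l) (at_right 0)"
  proof (rule order_tendstoI)
    fix a
    assume "a < l"
    moreover have "l \<le> f e" if "0 < e" for e
      unfolding l_def using bdd that by (intro cINF_lower) auto
    ultimately show "\<forall>\<^sub>F e in at_right 0. a < f e"
      unfolding eventually_at_right_field by (meson less_le_trans zero_less_one)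
  next
    fix a
    assume "l < a"
    then obtain d where "0 < d" "f d < a"
      unfolding l_def by (subst (asm) cINF_less_iff[OF _ bdd]) auto
    then show "\<forall>\<^sub>F e in at_right 0. f e < a"
      unfolding eventually_at_right_field using mono[of _ d] by (meson le_less_trans less_imp_le)
  qed
  then show ?thesis
    by blast
qed

section \<open>Convergence of decreasing families of matrices\<close>

text \<open>Entries are recovered from the real inner product alone: the unit vector scaled by the
  imaginary unit picks out the imaginary part.\<close>

lemma matrix_entry_eq_inner:
  "A $ i $ j = Complex (axis i 1 \<bullet> (A *v axis j 1)) (axis i \<i> \<bullet> (A *v axis j 1))"
  for A :: "'n::finite cmat"
proof -
  have "(A *v axis j 1) $ i = A $ i $ j"
    by (simp add: matrix_vector_mult_def axis_def if_distrib cong: if_cong)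
  then have "axis i z \<bullet> (A *v axis j 1) = z \<bullet> (A $ i $ j)" for z
    by (simp add: inner_axis')
  then show ?thesis
    by (simp add: complex_eq_iff inner_complex_def)
qed

lemma polarization:
  fixes A :: "'n::finite cmat"
  assumes "hermitian A"
  shows "x \<bullet> (A *v y) = ((x + y) \<bullet> (A *v (x + y)) - x \<bullet> (A *v x) - y \<bullet> (A *v y)) / 2"
proof -
  have "y \<bullet> (A *v x) = x \<bullet> (A *v y)"
    using assms inner_adjoint[of y A x] by (simp add: hermitian_def inner_commute)
  then show ?thesis
    by (simp add: matrix_vector_right_distrib inner_add_left inner_add_right)
qed

text \<open>Each quadratic form decreases and is bounded below, so it converges; polarization
  extends this to pairs of vectors, and the entries are built from such values.\<close>

lemma pos_semidef_decreasing_convergent: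
  fixes F :: "real \<Rightarrow> 'n::finite cmat"
  assumes psd: "\<And>e. 0 < e \<Longrightarrow> pos_semidef (F e)" and mono: "\<And>e d. 0 < e \<Longrightarrow> e \<le> d \<Longrightarrow> F e \<preceq> F d"
  shows "\<exists>L. (F \<longlongrightarrow> L) (at_right 0)"
proof -
  have "\<exists>l. ((\<lambda>e. x \<bullet> (F e *v x)) \<longlongrightarrow> l) (at_right 0)" for x
    using psd loewner_leD[OF mono] by (intro tendsto_mono_at_right_0) (auto simp: pos_semidef_iff)
  then obtain q where q: "\<And>x. ((\<lambda>e. x \<bullet> (F e *v x)) \<longlongrightarrow> q x) (at_right 0)"
    by metis
  define b where "b x y = (q (x + y) - q x - q y) / 2" for x y
  have b: "((\<lambda>e. x \<bullet> (F e *v y)) \<longlongrightarrow> b x y) (at_right 0)" for x y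
  proof -
    have "((\<lambda>e. ((x + y) \<bullet> (F e *v (x + y)) - x \<bullet> (F e *v x) - y \<bullet> (F e *v y)) / 2) \<longlongrightarrow> b x y) (at_right 0)"
      unfolding b_def by (intro tendsto_intros q) simp
    \<comment> \<open>Polarization needs a Hermitian matrix, which is known for positive
      \<open>e\<close> only, so the two functions are compared eventually.\<close>
    moreover have "\<forall>\<^sub>F e in at_right 0.
        ((x + y) \<bullet> (F e *v (x + y)) - x \<bullet> (F e *v x) - y \<bullet> (F e *v y)) / 2 = x \<bullet> (F e *v y)"
      using eventually_at_right_less
    proof eventually_elim
      case (elim e)
      then show ?case
        using polarization[of "F e" x y] psd by (simp add: pos_semidef_iff)
    qed
    ultimately show ?thesis
      by (rule Lim_transform_eventually)
  qed
  have "((\<lambda>e. F e $ i $ j) \<longlongrightarrow> Complex (b (axis i 1) (axis j 1)) (b (axis i \<i>) (axis j 1))) (at_right 0)" for i j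
    unfolding matrix_entry_eq_inner[of "F _"] by (intro tendsto_Complex b)
  then have "(F \<longlongrightarrow> (\<chi> i j. Complex (b (axis i 1) (axis j 1)) (b (axis i \<i>) (axis j 1)))) (at_right 0)"
    by (intro vec_tendstoI) simp
  then show ?thesis
    by blast
qed

lemma hermitian_limit:
  assumes F: "(F \<longlongrightarrow> L) (at_right (0::real))" and herm: "\<And>e. 0 < e \<Longrightarrow> hermitian (F e)"
  shows "hermitian L"
proof -
  have "cnj (L $ j $ i) = L $ i $ j" for i j
  proof (rule tendsto_unique)
    show "((\<lambda>e. F e $ i $ j) \<longlongrightarrow> L $ i $ j) (at_right 0)"
      by (intro tendsto_intros F)
    have "((\<lambda>e. cnj (F e $ j $ i)) \<longlongrightarrow> cnj (L $ j $ i)) (at_right 0)"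
      by (intro tendsto_intros F)
    moreover have "\<forall>\<^sub>F e in at_right 0. cnj (F e $ j $ i) = F e $ i $ j"
      using eventually_at_right_less
    proof eventually_elim
      case (elim e)
      then have "(F e)\<^sup>\<dagger> $ i $ j = F e $ i $ j"
        using herm by (simp add: hermitian_def)
      then show ?case
        by (simp add: mat_adjoint_def)
    qed
    ultimately show "((\<lambda>e. F e $ i $ j) \<longlongrightarrow> cnj (L $ j $ i)) (at_right 0)"
      by (rule Lim_transform_eventually)
  qed simp
  then show ?thesis
    by (simp add: hermitian_def mat_adjoint_def vec_eq_iff)
qed

lemma loewner_le_limit:
  assumes F: "(F \<longlongrightarrow> L) (at_right (0::real))" and G: "hermitian G"
    and herm: "\<And>e. 0 < e \<Longrightarrow> hermitian (F e)" and le: "\<And>e. 0 < e \<Longrightarrow> G \<preceq> F e"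
  shows "G \<preceq> L"
proof (rule loewner_leI[OF G hermitian_limit[OF F herm]])
  fix x
  have "\<forall>\<^sub>F e in at_right 0. x \<bullet> (G *v x) \<le> x \<bullet> (F e *v x)"
    using eventually_at_right_less by eventually_elim (simp add: loewner_leD le)
  then show "x \<bullet> (G *v x) \<le> x \<bullet> (L *v x)"
    by (rule tendsto_lowerbound[OF tendsto_inner_matrix_vector[OF F]]) simp
qed

lemma block_nonneg_limit:
  assumes F: "(F \<longlongrightarrow> P) (at_right (0::real))" "(G \<longlongrightarrow> M) (at_right 0)" "(H \<longlongrightarrow> Q) (at_right 0)"
    and bl: "\<And>e. 0 < e \<Longrightarrow> block_nonneg (F e) (G e) (H e)"
  shows "block_nonneg P M Q"
  unfolding block_nonneg_def
proof (intro allI)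
  fix x y
  have "\<forall>\<^sub>F e in at_right 0. 0 \<le> x \<bullet> (F e *v x) + 2 * (x \<bullet> (G e *v y)) + y \<bullet> (H e *v y)"
    using eventually_at_right_less by eventually_elim (use bl in \<open>simp add: block_nonneg_def\<close>)
  then show "0 \<le> x \<bullet> (P *v x) + 2 * (x \<bullet> (M *v y)) + y \<bullet> (Q *v y)"
    by (rule tendsto_lowerbound[rotated])
      (simp, intro tendsto_add tendsto_mult tendsto_const tendsto_inner_matrix_vector F)
qed

section \<open>Perturbation by multiples of the identity, and means of semidefinite matrices\<close>

lemma inner_add_scaleR_mat_1:
  "x \<bullet> ((A + e *\<^sub>R mat 1) *v x) = x \<bullet> (A *v x) + e * (x \<bullet> x)"
  for A :: "'n::finite cmat"
  by (simp add: matrix_vector_mult_add_rdistrib scaleR_matrix_vector inner_add_right)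

lemma hermitian_add_scaleR_mat_1: "hermitian A \<Longrightarrow> hermitian (A + e *\<^sub>R mat 1)"
  by (simp add: hermitian_def adjoint_add adjoint_scaleR)

lemma pos_def_add_scaleR_mat_1:
  assumes "pos_semidef A" "0 < e"
  shows "pos_def (A + e *\<^sub>R mat 1)"
  using assms by (auto simp: pos_def_iff pos_semidef_iff inner_add_scaleR_mat_1
      hermitian_add_scaleR_mat_1 intro: add_nonneg_pos)

lemma add_scaleR_mat_1_mono:
  assumes "hermitian A" "d \<le> e"
  shows "A + d *\<^sub>R mat 1 \<preceq> A + e *\<^sub>R mat 1"
  using assms by (intro loewner_leI) (auto simp: inner_add_scaleR_mat_1
      hermitian_add_scaleR_mat_1 intro: mult_right_mono)

text \<open>\<open>Lim\<close> is informative only once a limit is known to exist. Shrinking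
  \<open>e\<close> decreases both perturbed arguments, hence their mean, so the convergence result
  for decreasing families applies.\<close>

lemma geo_mean_tendsto:
  assumes A: "pos_semidef A" and C: "pos_semidef C" and t: "0 \<le> t" "t \<le> 1"
    and sing: "\<not> (pos_def A \<and> pos_def C)"
  shows "((\<lambda>e. geo_mean_pd t (A + e *\<^sub>R mat 1) (C + e *\<^sub>R mat 1)) \<longlongrightarrow> A \<sharp>\<^bsub>t\<^esub> C) (at_right 0)"
    (is "(?F \<longlongrightarrow> _) _")
proof -
  have "\<exists>L. (?F \<longlongrightarrow> L) (at_right 0)"
  proof (rule pos_semidef_decreasing_convergent)
    fix e d :: real
    assume "0 < e"
    then show "pos_semidef (?F e)"
      using A C by (intro pos_semidef_geo_mean_pd pos_def_add_scaleR_mat_1)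
    assume "e \<le> d"
    with \<open>0 < e\<close> have "0 < d"
      by simp
    show "?F e \<preceq> ?F d"
      using A C t \<open>0 < e\<close> \<open>0 < d\<close> \<open>e \<le> d\<close>
      by (intro geo_mean_pd_mono pos_def_add_scaleR_mat_1 add_scaleR_mat_1_mono) (auto simp: pos_semidef_iff)
  qed
  then obtain L where L: "(?F \<longlongrightarrow> L) (at_right 0)"
    by blast
  then have "Lim (at_right 0) ?F = L"
    by (intro tendsto_Lim) simp_all
  with L sing show ?thesis
    by (auto simp: geo_mean_def)
qed

lemma hermitian_geo_mean:
  assumes A: "pos_semidef A" and C: "pos_semidef C" and t: "0 \<le> t" "t \<le> 1"
  shows "hermitian (A \<sharp>\<^bsub>t\<^esub> C)"
proof (cases "pos_def A \<and> pos_def C")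
  case True
  then show ?thesis
    using pos_semidef_geo_mean_pd by (auto simp: geo_mean_def pos_semidef_iff)
next
  case False
  show ?thesis
  proof (rule hermitian_limit[OF geo_mean_tendsto[OF A C t False]])
    show "hermitian (geo_mean_pd t (A + e *\<^sub>R mat 1) (C + e *\<^sub>R mat 1))" if "0 < e" for e
      using pos_semidef_geo_mean_pd[OF pos_def_add_scaleR_mat_1[OF A that] pos_def_add_scaleR_mat_1[OF C that]]
      by (simp add: pos_semidef_iff)
  qed
qed

text \<open>The exponents \<open>t\<close> and \<open>1 - t\<close> average to 1/2. Block
  nonnegativity survives limits, so the singular case follows from the perturbed matrices.\<close>

lemma block_nonneg_geo_mean:
  assumes A: "pos_semidef A" and C: "pos_semidef C" and t: "0 \<le> t" "t \<le> 1"
  shows "block_nonneg (A \<sharp>\<^bsub>t\<^esub> C) (A \<sharp> C) (A \<sharp>\<^bsub>1 - t\<^esub> C)"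
proof (cases "pos_def A \<and> pos_def C")
  case True
  then show ?thesis
    using block_nonneg_geo_mean_pd[of A C t "1 - t"] by (simp add: geo_mean_def)
next
  case False
  show ?thesis
  proof (rule block_nonneg_limit)
    show "((\<lambda>e. geo_mean_pd t (A + e *\<^sub>R mat 1) (C + e *\<^sub>R mat 1)) \<longlongrightarrow> A \<sharp>\<^bsub>t\<^esub> C) (at_right 0)"
      "((\<lambda>e. geo_mean_pd (1/2) (A + e *\<^sub>R mat 1) (C + e *\<^sub>R mat 1)) \<longlongrightarrow> A \<sharp> C) (at_right 0)"
      "((\<lambda>e. geo_mean_pd (1 - t) (A + e *\<^sub>R mat 1) (C + e *\<^sub>R mat 1)) \<longlongrightarrow> A \<sharp>\<^bsub>1 - t\<^esub> C) (at_right 0)"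
      using t by (intro geo_mean_tendsto A C False; simp)+
    fix e :: real
    assume "0 < e"
    then show "block_nonneg (geo_mean_pd t (A + e *\<^sub>R mat 1) (C + e *\<^sub>R mat 1))
        (geo_mean_pd (1/2) (A + e *\<^sub>R mat 1) (C + e *\<^sub>R mat 1))
        (geo_mean_pd (1 - t) (A + e *\<^sub>R mat 1) (C + e *\<^sub>R mat 1))"
      using block_nonneg_geo_mean_pd[of _ _ t "1 - t", OF pos_def_add_scaleR_mat_1[OF A] pos_def_add_scaleR_mat_1[OF C]]
      by simp
  qed
qed

lemma block_nonneg_diagD:
  assumes "block_nonneg P G Q"
  shows "0 \<le> x \<bullet> (P *v x)" "0 \<le> x \<bullet> (Q *v x)"
  using assms[unfolded block_nonneg_def, rule_format, of x 0]
    assms[unfolded block_nonneg_def, rule_format, of 0 x] by simp_all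

text \<open>In the singular case, enlarging the diagonal blocks by \<open>e *\<^sub>R mat 1\<close>
  keeps \<open>G\<close> admissible, so the definite case bounds \<open>G\<close> for every positive
  \<open>e\<close> and the bound passes to the limit.\<close>

lemma block_nonneg_imp_le_geo_mean:
  assumes P: "hermitian P" and Q: "hermitian Q" and G: "hermitian G" and bl: "block_nonneg P G Q"
  shows "G \<preceq> P \<sharp> Q"
proof (cases "pos_def P \<and> pos_def Q")
  case True
  then show ?thesis
    using block_nonneg_imp_le_geo_mean_pd G bl by (auto simp: geo_mean_def)
next
  case False
  have psd: "pos_semidef P" "pos_semidef Q"
    using P Q block_nonneg_diagD[OF bl] by (auto simp: pos_semidef_iff)
  show ?thesis
  proof (rule loewner_le_limit[OF geo_mean_tendsto[OF psd _ _ False] G])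
    fix e :: real
    assume e: "0 < e"
    have pd: "pos_def (P + e *\<^sub>R mat 1)" "pos_def (Q + e *\<^sub>R mat 1)"
      using psd e by (simp_all add: pos_def_add_scaleR_mat_1)
    show "hermitian (geo_mean_pd (1/2) (P + e *\<^sub>R mat 1) (Q + e *\<^sub>R mat 1))"
      using pos_semidef_geo_mean_pd[OF pd] by (simp add: pos_semidef_iff)
    have "block_nonneg (P + e *\<^sub>R mat 1) G (Q + e *\<^sub>R mat 1)"
      using add_scaleR_mat_1_mono[of P 0 e] add_scaleR_mat_1_mono[of Q 0 e] P Q e
      by (intro block_nonneg_mono[OF bl]) simp_all
    then show "G \<preceq> geo_mean_pd (1/2) (P + e *\<^sub>R mat 1) (Q + e *\<^sub>R mat 1)"
      by (rule block_nonneg_imp_le_geo_mean_pd[OF pd G])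
  qed simp_all
qed

text \<open>By the extremal property, \<open>M \<le> A \<sharp> C\<close>; and \<open>A \<sharp> C\<close> is itself an admissible off-diagonal block
  for \<open>A \<sharp>\<^bsub>t\<^esub> C\<close> and \<open>A \<sharp>\<^bsub>1 - t\<^esub> C\<close>.\<close>

lemma block_nonneg_imp_le_geo_mean_geo_mean:
  assumes A: "hermitian A" and C: "hermitian C" and M: "hermitian M" and bl: "block_nonneg A M C"
    and t: "0 \<le> t" "t \<le> 1"
  shows "M \<preceq> (A \<sharp>\<^bsub>t\<^esub> C) \<sharp> (A \<sharp>\<^bsub>1 - t\<^esub> C)"
proof -
  have psd: "pos_semidef A" "pos_semidef C"
    using A C block_nonneg_diagD[OF bl] by (auto simp: pos_semidef_iff)
  have "A \<sharp> C \<preceq> (A \<sharp>\<^bsub>t\<^esub> C) \<sharp> (A \<sharp>\<^bsub>1 - t\<^esub> C)"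
    using psd t by (intro block_nonneg_imp_le_geo_mean block_nonneg_geo_mean hermitian_geo_mean) simp_all
  then show ?thesis
    using block_nonneg_imp_le_geo_mean[OF A C M bl] loewner_le_trans by blast
qed

section \<open>Absolute values and polar decompositions\<close>

text \<open>The entries of \<open>s\<close> are the squared singular values; they are nonnegative
  because the form of the product at \<open>x\<close> is the squared norm of
  \<open>X *v x\<close>.\<close>

lemma mat_abs_diagonalisation:
  fixes X :: "'n::finite cmat"
  obtains V s where "unitary V" "\<And>i. 0 \<le> s i" "X\<^sup>\<dagger> ** X = V ** diag_mat s ** V\<^sup>\<dagger>"
    "mat_abs X = V ** diag_mat (\<lambda>i. s i powr (1/2)) ** V\<^sup>\<dagger>"
proof -
  have psd: "pos_semidef (X\<^sup>\<dagger> ** X)"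
    by (simp add: pos_semidef_iff hermitian_def adjoint_mult inner_adjoint[of _ "X\<^sup>\<dagger>"]
        flip: matrix_vector_mul_assoc)
  then obtain V s where V: "unitary V" and eq: "X\<^sup>\<dagger> ** X = V ** diag_mat s ** V\<^sup>\<dagger>"
    using spectral_theorem unfolding pos_semidef_iff by blast
  show ?thesis
  proof (rule that[OF V _ eq])
    show "0 \<le> s i" for i
      using conj_diag_mat_nonneg[of "V\<^sup>\<dagger>" V s] V psd eq by (simp add: unitary_def)
    show "mat_abs X = V ** diag_mat (\<lambda>i. s i powr (1/2)) ** V\<^sup>\<dagger>"
      unfolding mat_abs_def mat_powr_def eq by (rule mat_fun_diagonalisation[OF V])
  qed
qed

lemma hermitian_mat_abs: "hermitian (mat_abs X)"
  by (rule mat_abs_diagonalisation[of X]) (simp add: hermitian_mult_adjoint)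

text \<open>\<open>X\<close> times its adjoint is the congruence by \<open>U\<close> of the square
  of \<open>mat_abs X\<close>, so \<open>U ** V\<close> diagonalises it with the same entries
  \<open>s\<close>, and square roots can be taken entrywise.\<close>

lemma mat_abs_adjoint_polar:
  fixes X :: "'n::finite cmat"
  assumes U: "unitary U" and X: "X = U ** mat_abs X"
  shows "mat_abs (X\<^sup>\<dagger>) = U ** mat_abs X ** U\<^sup>\<dagger>"
proof -
  obtain V s where V: "unitary V" and s: "\<And>i. 0 \<le> s i"
    and abs: "mat_abs X = V ** diag_mat (\<lambda>i. s i powr (1/2)) ** V\<^sup>\<dagger>"
    using mat_abs_diagonalisation by metis
  \<comment> \<open>Nonnegativity suffices here: at zero it holds because
    \<open>0 powr (1/2) = 0\<close>.\<close>
  have "s i powr (1/2) * s i powr (1/2) = s i" for i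
    using s[of i] by (simp add: powr_half_sqrt)
  then have sq: "mat_abs X ** mat_abs X = V ** diag_mat s ** V\<^sup>\<dagger>"
    by (simp add: abs unitary_conj_diag_mat_mult[OF V])
  have "X\<^sup>\<dagger> = mat_abs X ** U\<^sup>\<dagger>"
    using hermitian_mat_abs[of X] by (subst X) (simp add: adjoint_mult hermitian_def)
  then have "X ** X\<^sup>\<dagger> = (U ** mat_abs X) ** (mat_abs X ** U\<^sup>\<dagger>)"
    using X by simp
  also have "\<dots> = U ** (mat_abs X ** mat_abs X) ** U\<^sup>\<dagger>"
    by (simp only: matrix_mul_assoc)
  also have "\<dots> = (U ** V) ** diag_mat s ** (U ** V)\<^sup>\<dagger>"
    unfolding sq adjoint_mult by (simp only: matrix_mul_assoc)
  finally have "mat_abs (X\<^sup>\<dagger>) = (U ** V) ** diag_mat (\<lambda>i. s i powr (1/2)) ** (U ** V)\<^sup>\<dagger>"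
    by (simp add: mat_abs_def mat_powr_def mat_fun_diagonalisation[OF unitary_mult[OF U V]])
  then show ?thesis
    unfolding abs adjoint_mult by (simp only: matrix_mul_assoc)
qed

section \<open>From the block matrix hypothesis to the inequalities\<close>

lemma sum_UNIV_sum: "sum f (UNIV :: ('a::finite + 'b::finite) set) = (\<Sum>i\<in>UNIV. f (Inl i)) + (\<Sum>i\<in>UNIV. f (Inr i))"
  by (subst UNIV_Plus_UNIV[symmetric], subst sum.Plus) auto

lemma pos_semidef_block_matD:
  fixes A B X :: "'n::finite cmat"
  assumes "pos_semidef (block_mat A (X\<^sup>\<dagger>) X B)"
  shows "hermitian A" "hermitian B" "block_nonneg A (X\<^sup>\<dagger>) B"
proof -
  have "(block_mat A (X\<^sup>\<dagger>) X B)\<^sup>\<dagger> $ i $ j = block_mat A (X\<^sup>\<dagger>) X B $ i $ j" for i j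
    using assms by (simp add: pos_semidef_iff hermitian_def)
  from this[of "Inl _" "Inl _"] this[of "Inr _" "Inr _"] show "hermitian A" "hermitian B"
    by (simp_all add: hermitian_def mat_adjoint_def block_mat_def vec_eq_iff)
  show "block_nonneg A (X\<^sup>\<dagger>) B"
    unfolding block_nonneg_def
  proof (intro allI)
    fix x y :: "complex ^ 'n"
    \<comment> \<open>Stacking \<open>x\<close> over \<open>y\<close> evaluates the full block form;
      moving \<open>X\<close> across the inner product identifies its two cross terms.\<close>
    define z where "z = (\<chi> i. case i of Inl k \<Rightarrow> x $ k | Inr k \<Rightarrow> y $ k)"
    have "z \<bullet> (block_mat A (X\<^sup>\<dagger>) X B *v z) = x \<bullet> (A *v x + X\<^sup>\<dagger> *v y) + y \<bullet> (X *v x + B *v y)"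
      by (simp add: z_def block_mat_def inner_vec_def matrix_vector_mult_def sum_UNIV_sum)
    also have "y \<bullet> (X *v x + B *v y) = x \<bullet> (X\<^sup>\<dagger> *v y) + y \<bullet> (B *v y)"
      by (simp add: inner_add_right inner_adjoint[of y X x] inner_commute)
    finally have "z \<bullet> (block_mat A (X\<^sup>\<dagger>) X B *v z) = x \<bullet> (A *v x) + 2 * (x \<bullet> (X\<^sup>\<dagger> *v y)) + y \<bullet> (B *v y)"
      by (simp add: inner_add_right)
    moreover have "0 \<le> z \<bullet> (block_mat A (X\<^sup>\<dagger>) X B *v z)"
      using assms by (simp add: pos_semidef_iff)
    ultimately show "0 \<le> x \<bullet> (A *v x) + 2 * (x \<bullet> (X\<^sup>\<dagger> *v y)) + y \<bullet> (B *v y)"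
      by simp
  qed
qed

theorem theorem2p1:
  fixes A B X U :: "complex ^ 'n ^ 'n"
  assumes "pos_semidef (block_mat A (X\<^sup>\<dagger>) X B)"
    and "unitary U"
    and "X = U ** mat_abs X"
  shows "(\<forall>t. 0 \<le> t \<and> t \<le> 1 \<longrightarrow>
            mat_abs X \<preceq> (A \<sharp>\<^bsub>t\<^esub> (U\<^sup>\<dagger> ** B ** U)) \<sharp> (A \<sharp>\<^bsub>1 - t\<^esub> (U\<^sup>\<dagger> ** B ** U)) \<and>
            mat_abs (X\<^sup>\<dagger>) \<preceq> ((U ** A ** U\<^sup>\<dagger>) \<sharp>\<^bsub>t\<^esub> B) \<sharp> ((U ** A ** U\<^sup>\<dagger>) \<sharp>\<^bsub>1 - t\<^esub> B)) \<and>
         mat_abs X \<preceq> A \<sharp> (U\<^sup>\<dagger> ** B ** U) \<and>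
         mat_abs (X\<^sup>\<dagger>) \<preceq> (U ** A ** U\<^sup>\<dagger>) \<sharp> B"
proof -
  note AB = pos_semidef_block_matD[OF assms(1)]
  have "X\<^sup>\<dagger> = mat_abs X ** U\<^sup>\<dagger>"
    using hermitian_mat_abs[of X] by (subst assms(3)) (simp add: adjoint_mult hermitian_def)
  then have X: "X\<^sup>\<dagger> ** U = mat_abs X" "U ** X\<^sup>\<dagger> = mat_abs (X\<^sup>\<dagger>)"
    using assms(2) mat_abs_adjoint_polar[OF assms(2,3)]
    by (simp_all add: unitary_def flip: matrix_mul_assoc)
  have herm: "hermitian (U\<^sup>\<dagger> ** B ** U)" "hermitian (U ** A ** U\<^sup>\<dagger>)"
    using hermitian_mult_adjoint[OF AB(2), of "U\<^sup>\<dagger>"] hermitian_mult_adjoint[OF AB(1)] by simp_all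
  \<comment> \<open>The congruence with factors \<open>mat 1\<close> and the adjoint of
    \<open>U\<close> makes the off-diagonal block \<open>mat_abs X\<close>; the one with factors
    \<open>U\<close> and \<open>mat 1\<close> makes it the absolute value of the adjoint.\<close>
  have bl: "block_nonneg A (mat_abs X) (U\<^sup>\<dagger> ** B ** U)" "block_nonneg (U ** A ** U\<^sup>\<dagger>) (mat_abs (X\<^sup>\<dagger>)) B"
    using block_nonneg_congruence[OF AB(3), of "mat 1" "U\<^sup>\<dagger>"] block_nonneg_congruence[OF AB(3), of U "mat 1"]
    by (simp_all add: X)
  show ?thesis
    using block_nonneg_imp_le_geo_mean_geo_mean[OF AB(1) herm(1) hermitian_mat_abs bl(1)]
      block_nonneg_imp_le_geo_mean_geo_mean[OF herm(2) AB(2) hermitian_mat_abs bl(2)]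
      block_nonneg_imp_le_geo_mean[OF AB(1) herm(1) hermitian_mat_abs bl(1)]
      block_nonneg_imp_le_geo_mean[OF herm(2) AB(2) hermitian_mat_abs bl(2)]
    by blast
qed

end
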